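(* Let $P$ be an increasing graph property. Let $T$ and $T_0$ be monotone $P$-theorems, with $T_0$ weakly optimal. If $T$ declares a degree sequence $\pi$ to be forcibly $P$, then $T_0$ also declares $\pi$ to be forcibly $P$.
   Context: All graphs are finite and simple. A graph property $P$ is increasing if whenever a graph $G$ has $P$, so does every edge-augmented supergraph of $G$ (obtained by adding edges). An $n$-sequence is an integer sequence $\pi=(d_1\le\dots\le d_n)$, written in nondecreasing order, with $0\le d_j\le n-1$ for all $j$. It is graphical (a "degree sequence") if it is the sequence of vertex degrees of some graph, called a realization of it. For two $n$-sequences $\pi=(d_j)$, $\pi'=(d'_j)$, $\pi'$ majorizes $\pi$, written $\pi'\ge\pi$, if $d'_j\ge d_j$ for all $j$. A graphical sequence is forcibly $P$ if every realization of it has property $P$. A $P$-theorem (forcibly $P$-theorem) is a (true) theorem $T$ which declares certain degree sequences to be forcibly $P$ (so every degree sequence it declares forcibly $P$ is indeed forcibly $P$), rendering no decision on the remaining degree sequences. $T$ is monotone if, for any two degree sequences $\pi,\pi'$, whenever $T$ declares $\pi$ forcibly $P$ and $\pi'\ge\pi$, then $T$ declares $\pi'$ forcibly $P$. $T$ is weakly optimal if any sequence $\pi$ (not necessarily graphical) which $T$ does not declare forcibly $P$ is majorized by a degree sequence which is not forcibly $P$; for a nongraphical sequence, "declared" is understood as satisfying the numerical hypothesis of $T$. *)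

theory Defs
  imports "HOL-Library.Multiset" "Graph_Theory.Graph_Theory"
begin

text \<open>
  Finite simple graphs are the symmetric, loop-free, finite digraphs without parallel arcs
  of \<^locale>\<open>pair_graph\<close>: an edge \<open>{u, v}\<close> is the pair of arcs \<open>(u, v)\<close>, \<open>(v, u)\<close>, so the degree
  of a vertex is its \<^const>\<open>out_degree\<close>.  A graph property is a predicate on graphs with
  vertices in \<^typ>\<open>nat\<close>; since it is required to be invariant under isomorphism, this covers
  all finite graphs.
\<close>

definition graph_property :: "(nat pair_pre_digraph \<Rightarrow> bool) \<Rightarrow> bool" where
  "graph_property P \<longleftrightarrow>
    (\<forall>G H. pair_graph G \<and> pair_graph H \<and> digraph_iso (with_proj G) (with_proj H) \<longrightarrow>
      P G = P H)"

definition increasing :: "(nat pair_pre_digraph \<Rightarrow> bool) \<Rightarrow> bool" where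
  "increasing P \<longleftrightarrow>
    (\<forall>G H. pair_graph G \<and> pair_graph H \<and> spanning (with_proj G) (with_proj H) \<and> P G \<longrightarrow> P H)"

definition n_sequence :: "nat \<Rightarrow> nat list \<Rightarrow> bool" where
  "n_sequence n \<pi> \<longleftrightarrow> length \<pi> = n \<and> sorted \<pi> \<and> (\<forall>d\<in>set \<pi>. d \<le> n - 1)"

definition degree_sequence :: "nat pair_pre_digraph \<Rightarrow> nat list" where
  "degree_sequence G =
    sorted_list_of_multiset (image_mset (out_degree (with_proj G)) (mset_set (pverts G)))"

definition realizes :: "nat pair_pre_digraph \<Rightarrow> nat list \<Rightarrow> bool" where
  "realizes G \<pi> \<longleftrightarrow> pair_graph G \<and> degree_sequence G = \<pi>"

definition graphical :: "nat list \<Rightarrow> bool" where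
  "graphical \<pi> \<longleftrightarrow> (\<exists>G. realizes G \<pi>)"

lemma graphical_imp_n_sequence:
  assumes "graphical \<pi>"
  shows "n_sequence (length \<pi>) \<pi>"
proof -
  obtain G where "pair_graph G" and \<pi>: "degree_sequence G = \<pi>"
    using assms by (auto simp: graphical_def realizes_def)
  then interpret pair_graph G by simp
  have ms: "mset \<pi> = image_mset (out_degree (with_proj G)) (mset_set (pverts G))"
    unfolding \<pi>[symmetric] degree_sequence_def by simp
  have len: "length \<pi> = card (pverts G)"
    using arg_cong[OF ms, of size] by simp
  have set: "set \<pi> = out_degree (with_proj G) ` pverts G"
    using arg_cong[OF ms, of set_mset] pair_finite_verts by simp
  have "out_degree (with_proj G) v \<le> card (pverts G) - 1" if "v \<in> pverts G" for v
  proof -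
    have "out_arcs (with_proj G) v \<subseteq> Pair v ` (pverts G - {v})"
      using no_loops' wellformed' by (fastforce simp: out_arcs_def)
    then have "out_degree (with_proj G) v \<le> card (Pair v ` (pverts G - {v}))"
      unfolding out_degree_def using pair_finite_verts by (intro card_mono) auto
    also have "\<dots> \<le> card (pverts G - {v})"
      using pair_finite_verts by (intro card_image_le) auto
    also have "\<dots> = card (pverts G) - 1"
      using that by simp
    finally show ?thesis .
  qed
  moreover have "sorted \<pi>"
    unfolding \<pi>[symmetric] degree_sequence_def by simp
  ultimately show ?thesis
    unfolding n_sequence_def len set by auto
qed

definition majorizes :: "nat list \<Rightarrow> nat list \<Rightarrow> bool" where
  "majorizes \<pi>' \<pi> \<longleftrightarrow> list_all2 (\<le>) \<pi> \<pi>'"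

definition forcibly :: "(nat pair_pre_digraph \<Rightarrow> bool) \<Rightarrow> nat list \<Rightarrow> bool" where
  "forcibly P \<pi> \<longleftrightarrow> graphical \<pi> \<and> (\<forall>G. realizes G \<pi> \<longrightarrow> P G)"

text \<open>
  A \<open>P\<close>-theorem \<open>T\<close> is represented by its numerical hypothesis, a predicate on sequences:
  \<open>T \<pi>\<close> means that \<open>T\<close> declares \<open>\<pi>\<close> forcibly \<open>P\<close>.  Truth and monotonicity of \<open>T\<close> only concern
  graphical sequences; weak optimality also concerns nongraphical ones.
\<close>

definition P_theorem :: "(nat pair_pre_digraph \<Rightarrow> bool) \<Rightarrow> (nat list \<Rightarrow> bool) \<Rightarrow> bool" where
  "P_theorem P T \<longleftrightarrow> (\<forall>\<pi>. graphical \<pi> \<and> T \<pi> \<longrightarrow> forcibly P \<pi>)"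

definition monotone_theorem :: "(nat list \<Rightarrow> bool) \<Rightarrow> bool" where
  "monotone_theorem T \<longleftrightarrow>
    (\<forall>\<pi> \<pi>'. graphical \<pi> \<and> graphical \<pi>' \<and> T \<pi> \<and> majorizes \<pi>' \<pi> \<longrightarrow> T \<pi>')"

definition weakly_optimal :: "(nat pair_pre_digraph \<Rightarrow> bool) \<Rightarrow> (nat list \<Rightarrow> bool) \<Rightarrow> bool" where
  "weakly_optimal P T \<longleftrightarrow>
    (\<forall>n \<pi>. n_sequence n \<pi> \<and> \<not> T \<pi> \<longrightarrow>
      (\<exists>\<pi>'. graphical \<pi>' \<and> majorizes \<pi>' \<pi> \<and> \<not> forcibly P \<pi>'))"

end

theory Submission
  imports Defs
begin

text \<open>
  Were \<open>T\<^sub>0\<close> silent on \<open>\<pi>\<close>, weak optimality would place above \<open>\<pi>\<close> a degree sequence with a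
  realization that fails \<open>P\<close>. Monotonicity carries the declaration of \<open>T\<close> from \<open>\<pi>\<close> up to that
  sequence, where it contradicts the truth of \<open>T\<close>.
\<close>

theorem theorem1p3:
  fixes P :: "nat pair_pre_digraph \<Rightarrow> bool"
    and T T\<^sub>0 :: "nat list \<Rightarrow> bool"
    and \<pi> :: "nat list"
  assumes "graph_property P" and "increasing P"
    and "P_theorem P T" and "monotone_theorem T"
    and "P_theorem P T\<^sub>0" and "monotone_theorem T\<^sub>0"
    and "weakly_optimal P T\<^sub>0"
    and "graphical \<pi>" and "T \<pi>"
  shows "T\<^sub>0 \<pi>"
proof (rule ccontr)
  assume "\<not> T\<^sub>0 \<pi>"
  moreover have "n_sequence (length \<pi>) \<pi>"
    using \<open>graphical \<pi>\<close> by (rule graphical_imp_n_sequence)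
  ultimately obtain \<pi>' where \<pi>': "graphical \<pi>'" "majorizes \<pi>' \<pi>" "\<not> forcibly P \<pi>'"
    using \<open>weakly_optimal P T\<^sub>0\<close> unfolding weakly_optimal_def by blast
  have "T \<pi>'"
    using \<open>monotone_theorem T\<close> \<open>graphical \<pi>\<close> \<open>T \<pi>\<close> \<pi>'(1,2)
    unfolding monotone_theorem_def by blast
  then have "forcibly P \<pi>'"
    using \<open>P_theorem P T\<close> \<pi>'(1) unfolding P_theorem_def by blast
  with \<pi>'(3) show False by contradiction
qed

end
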